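(* Let $D>0$, $H>0$, $d_{\min}\ge 0$, $\eta\in(0,1]$, $P>0$, $\beta_0>0$, $\tau_E>0$. Let $\mathbf{w}_1=(-D/2,0)$ and $\mathbf{w}_2=(D/2,0)$. Consider the common energy maximization problem $$\max\ \min_{k\in\{1,2\}}\int_0^{\tau_E}\sum_{m=1}^2\frac{\eta P\beta_0}{\|\mathbf{q}_m(t)-\mathbf{w}_k\|^2+H^2}\,dt$$ over the class of symmetric fixed hovering locations, i.e. over $\mathbf{q}_1(t)=(x,0)$, $\mathbf{q}_2(t)=(-x,0)$ for all $t\in(0,\tau_E]$, where $x\in\mathbb{R}$ satisfies the collision avoidance constraint $|x|\ge d_{\min}/2$. Then optimal hovering locations are as follows. (i) If $D\le 2H/\sqrt{3}$, the maximum is attained at $\mathbf{q}_1(t)=(-d_{\min}/2,0)$ and $\mathbf{q}_2(t)=(d_{\min}/2,0)$ for all $t\in(0,\tau_E]$. (ii) If $D>2H/\sqrt{3}$, the maximum is attained at $\mathbf{q}_1(t)=(-\epsilon,0)$ and $\mathbf{q}_2(t)=(\epsilon,0)$ for all $t\in(0,\tau_E]$, where $$\epsilon=\max\left(\sqrt{-\left(\tfrac{D^2}{4}+H^2\right)+\sqrt{\tfrac{D^4}{4}+H^2D^2}},\ \tfrac{d_{\min}}{2}\right)\le\max\left(\tfrac{d_{\min}}{2},\tfrac{D}{2}\right).$$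
   Context: Two UAVs fly at altitude $H$; $\mathbf{q}_m(t)\in\mathbb{R}^2$ is the horizontal position of UAV $m\in\{1,2\}$ at time $t$. Two ground devices at distance $D$ have horizontal positions $\mathbf{w}_1,\mathbf{w}_2$. Each UAV transmits energy with power $P$; $\beta_0$ is the channel power gain at unit distance, $\eta$ the energy conversion efficiency, $\tau_E$ the duration of the wireless power transfer, and $d_{\min}$ the minimum allowed distance between the UAVs. The integral in the objective is the energy harvested by device $k$. For the symmetric placements considered, both devices harvest the same energy. *)

theory Defs
  imports "HOL-Analysis.Analysis"
begin

text \<open>UAVs and ground devices are both numbered by the naturals 1 and 2; a family of
  trajectories is a function \<open>q\<close> with \<open>q m t\<close> the horizontal position of UAV \<open>m\<close> at time \<open>t\<close>.
  Only the values at \<open>m \<in> {1, 2}\<close> and \<open>t \<in> (0, \<tau>\<^sub>E]\<close> matter.\<close>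

definition device_position :: "real \<Rightarrow> nat \<Rightarrow> real ^ 2" where
  "device_position D k = (if k = 1 then vector [- (D / 2), 0] else vector [D / 2, 0])"

definition harvested_energy ::
  "real \<Rightarrow> real \<Rightarrow> real \<Rightarrow> real \<Rightarrow> real \<Rightarrow> real \<Rightarrow> (nat \<Rightarrow> real \<Rightarrow> real ^ 2) \<Rightarrow> nat \<Rightarrow> real" where
  "harvested_energy D H \<eta> P \<beta>\<^sub>0 \<tau>\<^sub>E q k =
     integral {0..\<tau>\<^sub>E}
       (\<lambda>t. \<Sum>m\<in>{1, 2}. \<eta> * P * \<beta>\<^sub>0 / ((norm (q m t - device_position D k))\<^sup>2 + H\<^sup>2))"

definition common_energy ::
  "real \<Rightarrow> real \<Rightarrow> real \<Rightarrow> real \<Rightarrow> real \<Rightarrow> real \<Rightarrow> (nat \<Rightarrow> real \<Rightarrow> real ^ 2) \<Rightarrow> real" where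
  "common_energy D H \<eta> P \<beta>\<^sub>0 \<tau>\<^sub>E q = (MIN k\<in>{1, 2}. harvested_energy D H \<eta> P \<beta>\<^sub>0 \<tau>\<^sub>E q k)"

definition hovers_symmetrically :: "real \<Rightarrow> real \<Rightarrow> (nat \<Rightarrow> real \<Rightarrow> real ^ 2) \<Rightarrow> bool" where
  "hovers_symmetrically \<tau>\<^sub>E x q \<longleftrightarrow>
     (\<forall>t\<in>{0<..\<tau>\<^sub>E}. q 1 t = vector [x, 0] \<and> q 2 t = vector [- x, 0])"

definition feasible :: "real \<Rightarrow> real \<Rightarrow> (nat \<Rightarrow> real \<Rightarrow> real ^ 2) \<Rightarrow> bool" where
  "feasible d_min \<tau>\<^sub>E q \<longleftrightarrow> (\<exists>x. \<bar>x\<bar> \<ge> d_min / 2 \<and> hovers_symmetrically \<tau>\<^sub>E x q)"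

definition hover_offset :: "real \<Rightarrow> real \<Rightarrow> real \<Rightarrow> real" where
  "hover_offset D H d_min =
     max (sqrt (- (D ^ 2 / 4 + H ^ 2) + sqrt (D ^ 4 / 4 + H ^ 2 * D ^ 2))) (d_min / 2)"

end

theory Submission
  imports Defs
begin

text \<open>Each device harvests the energy \<open>\<tau>\<^sub>E\<eta>P\<beta>\<^sub>0 \<cdot> 2 / (u + K / u - D\<^sup>2)\<close>, where
  \<open>u = x\<^sup>2 + D\<^sup>2/4 + H\<^sup>2\<close> and \<open>K = D\<^sup>4/4 + H\<^sup>2D\<^sup>2\<close>. The function \<open>u + K / u\<close> decreases up to
  \<open>sqrt K\<close> and increases afterwards, so on \<open>u \<ge> u\<^sub>0 = d_min\<^sup>2/4 + D\<^sup>2/4 + H\<^sup>2\<close> it is least at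
  \<open>max (sqrt K) u\<^sub>0\<close>. Finally \<open>sqrt K > D\<^sup>2/4 + H\<^sup>2\<close> holds exactly when \<open>D > 2H / sqrt 3\<close>.\<close>

definition pair_gain :: "real \<Rightarrow> real \<Rightarrow> real \<Rightarrow> real" where
  "pair_gain D H x = 1 / ((x + D / 2)\<^sup>2 + H\<^sup>2) + 1 / ((x - D / 2)\<^sup>2 + H\<^sup>2)"

lemma norm_vector_2_diff_sq:
  fixes a b c :: real
  shows "(norm (vector [a, 0] - vector [b, 0] :: real ^ 2))\<^sup>2 = (a - b)\<^sup>2"
  unfolding power2_norm_eq_inner by (simp add: inner_vec_def sum_2 power2_eq_square)

text \<open>The trajectories are prescribed only for \<open>t > 0\<close>, while the integral runs
  over \<open>{0..\<tau>\<^sub>E}\<close>; the single point \<open>0\<close> is negligible, so the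
  integrand may be replaced by a constant.\<close>

lemma harvested_energy_hovering:
  assumes "hovers_symmetrically \<tau>\<^sub>E x q" and "\<tau>\<^sub>E \<ge> 0"
  shows "harvested_energy D H \<eta> P \<beta>\<^sub>0 \<tau>\<^sub>E q k = \<tau>\<^sub>E * (\<eta> * P * \<beta>\<^sub>0 * pair_gain D H x)"
proof -
  have "harvested_energy D H \<eta> P \<beta>\<^sub>0 \<tau>\<^sub>E q k
      = integral {0..\<tau>\<^sub>E} (\<lambda>t. \<eta> * P * \<beta>\<^sub>0 * pair_gain D H x)"
    unfolding harvested_energy_def
  proof (rule integral_spike[of "{0}"])
    fix t assume "t \<in> {0..\<tau>\<^sub>E} - {0}"
    then have q: "q 1 t = vector [x, 0]" "q 2 t = vector [- x, 0]"
      using assms(1) by (auto simp: hovers_symmetrically_def)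
    \<comment> \<open>Mirror symmetry: each UAV is as far from one device as the other UAV is from
      the other device, so changing \<open>k\<close> only swaps the two summands.\<close>
    have "(x - D / 2)\<^sup>2 = (- x - - (D / 2))\<^sup>2" "(x + D / 2)\<^sup>2 = (- x - D / 2)\<^sup>2"
      by (simp_all add: power2_eq_square algebra_simps)
    then show "\<eta> * P * \<beta>\<^sub>0 * pair_gain D H x
        = (\<Sum>m\<in>{1, 2}. \<eta> * P * \<beta>\<^sub>0 / ((norm (q m t - device_position D k))\<^sup>2 + H\<^sup>2))"
      using q by (simp add: device_position_def norm_vector_2_diff_sq pair_gain_def distrib_left)
  qed simp
  then show ?thesis
    using assms(2) by simp
qed

lemma common_energy_hovering:
  assumes "hovers_symmetrically \<tau>\<^sub>E x q" and "\<tau>\<^sub>E \<ge> 0"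
  shows "common_energy D H \<eta> P \<beta>\<^sub>0 \<tau>\<^sub>E q = \<tau>\<^sub>E * (\<eta> * P * \<beta>\<^sub>0 * pair_gain D H x)"
  by (simp add: common_energy_def harvested_energy_hovering[OF assms])

lemma pair_gain_eq:
  assumes "H > 0" and "u = x\<^sup>2 + D\<^sup>2 / 4 + H\<^sup>2"
  shows "u + (D ^ 4 / 4 + H\<^sup>2 * D\<^sup>2) / u - D\<^sup>2 > 0"
    and "pair_gain D H x = 2 / (u + (D ^ 4 / 4 + H\<^sup>2 * D\<^sup>2) / u - D\<^sup>2)"
proof -
  define p where "p = (x + D / 2)\<^sup>2 + H\<^sup>2"
  define r where "r = (x - D / 2)\<^sup>2 + H\<^sup>2"
  have pos: "p > 0" "r > 0" "u > 0"
    using assms by (simp_all add: p_def r_def add_nonneg_pos)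
  have sum: "p + r = 2 * u"
    by (simp add: p_def r_def assms(2) power2_eq_square algebra_simps)
  \<comment> \<open>Since \<open>p = u + D * x\<close> and \<open>r = u - D * x\<close>, the product
    is \<open>u\<^sup>2 - D\<^sup>2 * x\<^sup>2\<close>; eliminating \<open>x\<^sup>2\<close> in
    favour of \<open>u\<close> produces the constant \<open>K\<close>.\<close>
  have "p * r = u\<^sup>2 + (D ^ 4 / 4 + H\<^sup>2 * D\<^sup>2) - D\<^sup>2 * u"
    unfolding p_def r_def assms(2) by (simp add: field_simps power2_eq_square power4_eq_xxxx)
  moreover have "u + K / u - D\<^sup>2 = (u\<^sup>2 + K - D\<^sup>2 * u) / u" for K
    using pos by (simp add: field_simps power2_eq_square)
  ultimately have prod: "u + (D ^ 4 / 4 + H\<^sup>2 * D\<^sup>2) / u - D\<^sup>2 = p * r / u"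
    by simp
  then show "u + (D ^ 4 / 4 + H\<^sup>2 * D\<^sup>2) / u - D\<^sup>2 > 0"
    using pos by simp
  have "pair_gain D H x = (p + r) / (p * r)"
    unfolding pair_gain_def p_def[symmetric] r_def[symmetric]
    using pos by (simp add: add_divide_distrib)
  then show "pair_gain D H x = 2 / (u + (D ^ 4 / 4 + H\<^sup>2 * D\<^sup>2) / u - D\<^sup>2)"
    by (simp add: prod sum)
qed

lemma add_divide_least_at_max:
  fixes K u\<^sub>0 v :: real
  assumes "K \<ge> 0" and "u\<^sub>0 > 0" and "v \<ge> u\<^sub>0" and u: "u = max (sqrt K) u\<^sub>0"
  shows "u + K / u \<le> v + K / v"
proof -
  have pos: "u > 0" "v > 0"
    using assms by auto
  have K: "K = sqrt K * sqrt K"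
    using assms(1) by simp
  have "0 \<le> (v - u) * (u * v - K)"
  proof (cases "u \<le> v")
    case True
    moreover have "sqrt K * sqrt K \<le> u * v"
      using True assms(1) u pos by (intro mult_mono) auto
    ultimately show ?thesis
      using K by simp
  next
    case False
    \<comment> \<open>Here \<open>v < u\<close> and \<open>v \<ge> u\<^sub>0\<close>, so the maximum
      cannot be \<open>u\<^sub>0\<close>.\<close>
    then have "u = sqrt K"
      using assms(3) u by auto
    moreover from this have "u * v \<le> sqrt K * sqrt K"
      using False assms(1) by (simp only:) (intro mult_left_mono, auto)
    ultimately show ?thesis
      using False K by (simp add: mult_nonpos_nonpos)
  qed
  also have "(v - u) * (u * v - K) = (v + K / v) * (u * v) - (u + K / u) * (u * v)"
    using pos by (simp add: field_simps)
  finally show ?thesis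
    using pos mult_right_le_imp_le[of "u + K / u" "u * v" "v + K / v"] by simp
qed

text \<open>Serves both regimes: \<open>opt\<close> says that \<open>y\<close> realises the
  minimiser of \<open>u + K / u\<close>, and the collision constraint on a competitor
  \<open>x\<close> becomes a lower bound on its \<open>u\<close>.\<close>

lemma is_arg_max_common_energy:
  assumes "H > 0" "d_min \<ge> 0" "\<eta> > 0" "P > 0" "\<beta>\<^sub>0 > 0" "\<tau>\<^sub>E > 0"
    and y: "\<bar>y\<bar> \<ge> d_min / 2"
    and opt: "y\<^sup>2 + D\<^sup>2 / 4 + H\<^sup>2
      = max (sqrt (D ^ 4 / 4 + H\<^sup>2 * D\<^sup>2)) ((d_min / 2)\<^sup>2 + D\<^sup>2 / 4 + H\<^sup>2)"
    and q: "hovers_symmetrically \<tau>\<^sub>E y q"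
  shows "is_arg_max (common_energy D H \<eta> P \<beta>\<^sub>0 \<tau>\<^sub>E) (feasible d_min \<tau>\<^sub>E) q"
proof -
  have gain: "pair_gain D H x \<le> pair_gain D H y" if "\<bar>x\<bar> \<ge> d_min / 2" for x
  proof -
    have "(d_min / 2)\<^sup>2 \<le> x\<^sup>2"
      using power_mono[OF that, of 2] assms(2) by simp
    then have "(y\<^sup>2 + D\<^sup>2 / 4 + H\<^sup>2) + (D ^ 4 / 4 + H\<^sup>2 * D\<^sup>2) / (y\<^sup>2 + D\<^sup>2 / 4 + H\<^sup>2)
        \<le> (x\<^sup>2 + D\<^sup>2 / 4 + H\<^sup>2) + (D ^ 4 / 4 + H\<^sup>2 * D\<^sup>2) / (x\<^sup>2 + D\<^sup>2 / 4 + H\<^sup>2)"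
      using assms(1) by (intro add_divide_least_at_max[OF _ _ _ opt]) (auto simp: add_nonneg_pos)
    then show ?thesis
      \<comment> \<open>Both gains are \<open>2\<close> over a positive denominator, so the smaller
        denominator gives the larger gain.\<close>
      unfolding pair_gain_eq(2)[OF assms(1) refl]
      using pair_gain_eq(1)[OF assms(1) refl] by (intro divide_left_mono mult_pos_pos) auto
  qed
  have "common_energy D H \<eta> P \<beta>\<^sub>0 \<tau>\<^sub>E q' \<le> common_energy D H \<eta> P \<beta>\<^sub>0 \<tau>\<^sub>E q"
    if q': "feasible d_min \<tau>\<^sub>E q'" for q'
  proof -
    obtain x where x: "\<bar>x\<bar> \<ge> d_min / 2" "hovers_symmetrically \<tau>\<^sub>E x q'"
      using q' by (auto simp: feasible_def)
    show ?thesis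
      using gain[OF x(1)] assms
      by (simp add: common_energy_hovering[OF x(2)] common_energy_hovering[OF q])
  qed
  then show ?thesis
    using q y by (auto simp: is_arg_max_linorder feasible_def)
qed

lemma threshold_iff:
  fixes D H :: real
  assumes "D > 0" and "H > 0"
  shows "D \<le> 2 * H / sqrt 3 \<longleftrightarrow> sqrt (D ^ 4 / 4 + H\<^sup>2 * D\<^sup>2) \<le> D\<^sup>2 / 4 + H\<^sup>2"
proof -
  have "0 < D\<^sup>2 / 4 + H\<^sup>2"
    using assms by (simp add: add_pos_pos)
  note cancel = mult_le_cancel_right_pos[OF this]
  have "D \<le> 2 * H / sqrt 3 \<longleftrightarrow> D\<^sup>2 \<le> (2 * H / sqrt 3)\<^sup>2"
    using assms by (intro power_mono_iff[symmetric]) auto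
  also have "\<dots> \<longleftrightarrow> D\<^sup>2 \<le> D\<^sup>2 / 4 + H\<^sup>2"
    by (simp add: power_divide power_mult_distrib field_simps)
  \<comment> \<open>This factor turns the left side into \<open>K\<close> and the right side into a
    perfect square.\<close>
  also have "\<dots> \<longleftrightarrow> D\<^sup>2 * (D\<^sup>2 / 4 + H\<^sup>2) \<le> (D\<^sup>2 / 4 + H\<^sup>2) * (D\<^sup>2 / 4 + H\<^sup>2)"
    by (simp only: cancel)
  also have "D\<^sup>2 * (D\<^sup>2 / 4 + H\<^sup>2) = D ^ 4 / 4 + H\<^sup>2 * D\<^sup>2"
    by (simp add: field_simps power2_eq_square power4_eq_xxxx)
  also have "D ^ 4 / 4 + H\<^sup>2 * D\<^sup>2 \<le> (D\<^sup>2 / 4 + H\<^sup>2) * (D\<^sup>2 / 4 + H\<^sup>2) \<longleftrightarrow>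
      sqrt (D ^ 4 / 4 + H\<^sup>2 * D\<^sup>2) \<le> sqrt ((D\<^sup>2 / 4 + H\<^sup>2) * (D\<^sup>2 / 4 + H\<^sup>2))"
    by (rule real_sqrt_le_iff[symmetric])
  also have "sqrt ((D\<^sup>2 / 4 + H\<^sup>2) * (D\<^sup>2 / 4 + H\<^sup>2)) = D\<^sup>2 / 4 + H\<^sup>2"
    by (simp add: add_nonneg_nonneg)
  finally show ?thesis .
qed

text \<open>Adding \<open>H ^ 4\<close> to \<open>K\<close> completes the square of
  \<open>D\<^sup>2 / 2 + H\<^sup>2\<close>, so the outer radicand is at most
  \<open>D\<^sup>2 / 4\<close>.\<close>

lemma hover_offset_le:
  assumes "D \<ge> 0"
  shows "hover_offset D H d_min \<le> max (d_min / 2) (D / 2)"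
proof -
  have "(D\<^sup>2 / 2 + H\<^sup>2)\<^sup>2 = D ^ 4 / 4 + H\<^sup>2 * D\<^sup>2 + (H\<^sup>2)\<^sup>2"
    by (simp add: field_simps power2_eq_square power4_eq_xxxx)
  then have "sqrt (D ^ 4 / 4 + H\<^sup>2 * D\<^sup>2) \<le> D\<^sup>2 / 2 + H\<^sup>2"
    by (intro real_le_lsqrt) auto
  then have "sqrt (- (D\<^sup>2 / 4 + H\<^sup>2) + sqrt (D ^ 4 / 4 + H\<^sup>2 * D\<^sup>2)) \<le> D / 2"
    using assms by (intro real_le_lsqrt) (auto simp: power_divide)
  then show ?thesis
    by (auto simp: hover_offset_def)
qed

text \<open>The first assumption makes the outer radicand nonnegative, so squaring undoes the root
  and commutes with \<open>max\<close>; adding \<open>D\<^sup>2 / 4 + H\<^sup>2\<close> then leaves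
  \<open>sqrt K\<close>. This is \<open>opt\<close> for the second regime.\<close>

lemma hover_offset_sq:
  assumes "sqrt (D ^ 4 / 4 + H\<^sup>2 * D\<^sup>2) \<ge> D\<^sup>2 / 4 + H\<^sup>2" and "d_min \<ge> 0"
  shows "(hover_offset D H d_min)\<^sup>2 + D\<^sup>2 / 4 + H\<^sup>2
    = max (sqrt (D ^ 4 / 4 + H\<^sup>2 * D\<^sup>2)) ((d_min / 2)\<^sup>2 + D\<^sup>2 / 4 + H\<^sup>2)"
proof -
  define s where "s = - (D\<^sup>2 / 4 + H\<^sup>2) + sqrt (D ^ 4 / 4 + H\<^sup>2 * D\<^sup>2)"
  have s: "s \<ge> 0"
    using assms(1) by (simp add: s_def)
  have "(max a b)\<^sup>2 = max (a\<^sup>2) (b\<^sup>2)" if "a \<ge> 0" "b \<ge> 0" for a b :: real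
    using that by (auto simp: max_def power_mono_iff)
  then have "(hover_offset D H d_min)\<^sup>2 = max s ((d_min / 2)\<^sup>2)"
    using s assms(2) unfolding hover_offset_def s_def[symmetric] by simp
  then show ?thesis
    unfolding s_def by (simp add: max_def)
qed

theorem lemma3p1:
  fixes D H d_min \<eta> P \<beta>\<^sub>0 \<tau>\<^sub>E :: real
  assumes "D > 0" and "H > 0" and "d_min \<ge> 0" and "0 < \<eta>" and "\<eta> \<le> 1"
    and "P > 0" and "\<beta>\<^sub>0 > 0" and "\<tau>\<^sub>E > 0"
  shows "(D \<le> 2 * H / sqrt 3 \<longrightarrow>
            (\<forall>q. hovers_symmetrically \<tau>\<^sub>E (- (d_min / 2)) q \<longrightarrow>
               is_arg_max (common_energy D H \<eta> P \<beta>\<^sub>0 \<tau>\<^sub>E) (feasible d_min \<tau>\<^sub>E) q)) \<and>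
         (D > 2 * H / sqrt 3 \<longrightarrow>
            (\<forall>q. hovers_symmetrically \<tau>\<^sub>E (- hover_offset D H d_min) q \<longrightarrow>
               is_arg_max (common_energy D H \<eta> P \<beta>\<^sub>0 \<tau>\<^sub>E) (feasible d_min \<tau>\<^sub>E) q) \<and>
            hover_offset D H d_min \<le> max (d_min / 2) (D / 2))"
proof (intro conjI impI allI)
  fix q assume D: "D \<le> 2 * H / sqrt 3" and q: "hovers_symmetrically \<tau>\<^sub>E (- (d_min / 2)) q"
  have "sqrt (D ^ 4 / 4 + H\<^sup>2 * D\<^sup>2) \<le> D\<^sup>2 / 4 + H\<^sup>2"
    using D threshold_iff assms(1,2) by simp
  moreover have "(d_min / 2)\<^sup>2 \<ge> 0"
    by simp
  \<comment> \<open>Below the threshold \<open>sqrt K\<close> lies under every admissible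
    \<open>u\<close>, so the maximum is its second argument and the UAVs hover as close together as
    allowed.\<close>
  ultimately have "(- (d_min / 2))\<^sup>2 + D\<^sup>2 / 4 + H\<^sup>2
      = max (sqrt (D ^ 4 / 4 + H\<^sup>2 * D\<^sup>2)) ((d_min / 2)\<^sup>2 + D\<^sup>2 / 4 + H\<^sup>2)"
    unfolding power2_minus by linarith
  then show "is_arg_max (common_energy D H \<eta> P \<beta>\<^sub>0 \<tau>\<^sub>E) (feasible d_min \<tau>\<^sub>E) q"
    using assms by (intro is_arg_max_common_energy[OF _ _ _ _ _ _ _ _ q]) auto
next
  fix q assume D: "D > 2 * H / sqrt 3"
    and q: "hovers_symmetrically \<tau>\<^sub>E (- hover_offset D H d_min) q"
  have "(- hover_offset D H d_min)\<^sup>2 + D\<^sup>2 / 4 + H\<^sup>2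
      = max (sqrt (D ^ 4 / 4 + H\<^sup>2 * D\<^sup>2)) ((d_min / 2)\<^sup>2 + D\<^sup>2 / 4 + H\<^sup>2)"
    unfolding power2_minus
    using D threshold_iff[OF assms(1,2)] assms(3) by (intro hover_offset_sq) auto
  moreover have "\<bar>- hover_offset D H d_min\<bar> \<ge> d_min / 2"
    using abs_ge_self[of "hover_offset D H d_min"] by (simp add: hover_offset_def)
  ultimately show "is_arg_max (common_energy D H \<eta> P \<beta>\<^sub>0 \<tau>\<^sub>E) (feasible d_min \<tau>\<^sub>E) q"
    using assms by (intro is_arg_max_common_energy[OF _ _ _ _ _ _ _ _ q])
next
  show "hover_offset D H d_min \<le> max (d_min / 2) (D / 2)"
    using assms(1) by (simp add: hover_offset_le)
qed

end
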